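(* For $k\in\mathbb{N}^+$ let $T_k=\{n\in\mathbb{N}^+ : n\geq k\}$ and $E_k=\{n\in\mathbb{N}^+ : n\geq k \text{ and } n \text{ is even}\}$. Let $\mathcal{B}=\{E_2\}\cup\{T_n : n\in\mathbb{N}^+\}$ and let $\mathcal{T}$ be the collection of arbitrary unions of finite intersections of elements of $\mathcal{B}$ (the topology on $\mathbb{N}^+$ with sub-basis $\mathcal{B}$). Let $\mathcal{U}$ be the set of all spectra $Spec(\Gamma)\subseteq\mathbb{N}^+$, where $\Gamma$ ranges over theories in the extension of $S^{\dagger}(card)$ by Boolean connectives at the sentence level. Then $\mathcal{U}=\mathcal{T}$. Explicitly, $$\mathcal{U}=\mathcal{T}=\{\varnothing\}\cup\{T_a : a\in\mathbb{N}^+\}\cup\{E_b : b\in\mathbb{N}^+\}\cup\{T_a\cup E_b : a,b\in\mathbb{N}^+,\ b<a\}.$$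
   Context: $\mathbb{N}^+$ is the set of positive integers. Syntax of $S^{\dagger}(card)$. Given a set $P_0$ of raw variables, each $p\in P_0$ has a complemented variable $\bar p$; put $\overline{P_0}=\{\bar p : p\in P_0\}$ and $P=P_0\cup\overline{P_0}$ (disjoint). Elements of $P$ are called nouns, and we set $\bar{\bar p}=p$ for $p\in P_0$. For $x,y\in P$ the sentences of $S^{\dagger}(card)$ are $\forall(x,y)$, $\exists(x,y)$, $\exists^{\geq}(x,y)$, $\exists^{>}(x,y)$. Boolean extension. The sentences of the extended language are built from the sentences of $S^{\dagger}(card)$ (treated as atomic) by recursively applying $\land$, $\lor$, $\neg$. A theory in the extended language is an arbitrary (possibly infinite) set of its sentences. The set of raw variables is not fixed in advance: a theory may be written over any set $P_0$ of raw variables. Semantics. A model $\mathfrak{M}=\langle M,I\rangle$ consists of a finite set $M$ and a function $I:P\to\mathcal{P}(M)$ such that $I(\bar x)=M\setminus I(x)$ for all raw variables $x\in P_0$. Satisfaction of atomic sentences: $\mathfrak{M}\models\forall(x,y)$ iff $I(x)\subseteq I(y)$; $\mathfrak{M}\models\exists(x,y)$ iff $I(x)\cap I(y)\neq\varnothing$; $\mathfrak{M}\models\exists^{\geq}(x,y)$ iff $|I(x)|\geq|I(y)|$; $\mathfrak{M}\models\exists^{>}(x,y)$ iff $|I(x)|>|I(y)|$. The connectives $\land,\lor,\neg$ have their usual truth-functional semantics. $\mathfrak{M}\models\Gamma$ means $\mathfrak{M}\models\phi$ for all $\phi\in\Gamma$. Spectra. $Spec(\Gamma)=\{n\in\mathbb{N}^+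 : \Gamma \text{ has a model } \langle M,I\rangle \text{ with } |M|=n\}$. *)

theory Defs
  imports Main "HOL-Library.Set_Idioms"
begin

datatype 'v noun = Raw 'v | Bar 'v

datatype 'v atom =
    All "'v noun" "'v noun"
  | Exists "'v noun" "'v noun"
  | AtLeast "'v noun" "'v noun"
  | More "'v noun" "'v noun"

datatype (vars: 'v) sentence =
    Atom "'v atom"
  | And "'v sentence" "'v sentence"
  | Or "'v sentence" "'v sentence"
  | Neg "'v sentence"

definition theory_over :: "'v set \<Rightarrow> 'v sentence set \<Rightarrow> bool" where
  "theory_over P0 \<Gamma> \<longleftrightarrow> (\<forall>\<phi>\<in>\<Gamma>. vars \<phi> \<subseteq> P0)"

text \<open>
  The interpretation is a total function; only its values at the nouns over the set
  \<open>P0\<close> of raw variables are constrained. The universe may be empty; the empty model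
  never contributes to a spectrum.
\<close>

definition is_model :: "'v set \<Rightarrow> 'm set \<Rightarrow> ('v noun \<Rightarrow> 'm set) \<Rightarrow> bool" where
  "is_model P0 M I \<longleftrightarrow>
     finite M \<and> (\<forall>p\<in>P0. I (Raw p) \<subseteq> M \<and> I (Bar p) = M - I (Raw p))"

fun sat_atom :: "('v noun \<Rightarrow> 'm set) \<Rightarrow> 'v atom \<Rightarrow> bool" where
  "sat_atom I (All x y) \<longleftrightarrow> I x \<subseteq> I y"
| "sat_atom I (Exists x y) \<longleftrightarrow> I x \<inter> I y \<noteq> {}"
| "sat_atom I (AtLeast x y) \<longleftrightarrow> card (I x) \<ge> card (I y)"
| "sat_atom I (More x y) \<longleftrightarrow> card (I x) > card (I y)"

fun sat :: "('v noun \<Rightarrow> 'm set) \<Rightarrow> 'v sentence \<Rightarrow> bool" where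
  "sat I (Atom \<alpha>) \<longleftrightarrow> sat_atom I \<alpha>"
| "sat I (And \<phi> \<psi>) \<longleftrightarrow> sat I \<phi> \<and> sat I \<psi>"
| "sat I (Or \<phi> \<psi>) \<longleftrightarrow> sat I \<phi> \<or> sat I \<psi>"
| "sat I (Neg \<phi>) \<longleftrightarrow> \<not> sat I \<phi>"

abbreviation Npos :: "nat set" where
  "Npos \<equiv> {n. n \<ge> 1}"

text \<open>
  Every finite model is isomorphic to one whose universe is a set of natural numbers, so
  the spectrum quantifies over such models only; lemma \<open>card_in_Spec\<close> below
  confirms that models over any other type contribute nothing new.
\<close>

definition Spec :: "'v set \<Rightarrow> 'v sentence set \<Rightarrow> nat set" where
  "Spec P0 \<Gamma> =
     {n \<in> Npos. \<exists>(M :: nat set) I. is_model P0 M I \<and> (\<forall>\<phi>\<in>\<Gamma>. sat I \<phi>) \<and> card M = n}"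

lemma sat_image:
  assumes f: "inj_on f M" and I: "\<And>p. p \<in> vars \<phi> \<Longrightarrow> I (Raw p) \<subseteq> M \<and> I (Bar p) \<subseteq> M"
  shows "sat (\<lambda>x. f ` I x) \<phi> \<longleftrightarrow> sat I \<phi>"
  using I
proof (induction \<phi>)
  case (Atom \<alpha>)
  have sub: "I x \<subseteq> M" if "set_noun x \<subseteq> set_atom \<alpha>" for x
  proof (cases x)
    case (Raw p)
    then show ?thesis using Atom[of p] that by auto
  next
    case (Bar p)
    then show ?thesis using Atom[of p] that by auto
  qed
  have c: "card (f ` I x) = card (I x)" if "set_noun x \<subseteq> set_atom \<alpha>" for x
    using card_image[OF inj_on_subset[OF f sub[OF that]]] .
  show ?case
  proof (cases \<alpha>)
    case (All x y)
    then have xy: "I x \<subseteq> M" "I y \<subseteq> M" using sub by simp_all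
    have "f ` I x \<subseteq> f ` I y \<longleftrightarrow> f ` (I x \<union> I y) = f ` I y"
      by (simp add: image_Un subset_Un_eq)
    also have "\<dots> \<longleftrightarrow> I x \<union> I y = I y"
      using f xy by (intro inj_on_image_eq_iff) simp_all
    also have "\<dots> \<longleftrightarrow> I x \<subseteq> I y"
      by (simp add: subset_Un_eq)
    finally show ?thesis using All by simp
  next
    case (Exists x y)
    then have "f ` (I x \<inter> I y) = f ` I x \<inter> f ` I y"
      using sub by (intro inj_on_image_Int[OF f]) simp_all
    then have "f ` I x \<inter> f ` I y \<noteq> {} \<longleftrightarrow> I x \<inter> I y \<noteq> {}"
      by (metis image_is_empty)
    with Exists show ?thesis by simp
  next
    case (AtLeast x y)
    then show ?thesis using c[of x] c[of y] by simp
  next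
    case (More x y)
    then show ?thesis using c[of x] c[of y] by simp
  qed
qed simp_all

lemma card_in_Spec:
  fixes M :: "'m set"
  assumes "theory_over P0 \<Gamma>" "is_model P0 M I" "\<forall>\<phi>\<in>\<Gamma>. sat I \<phi>" "M \<noteq> {}"
  shows "card M \<in> Spec P0 \<Gamma>"
proof -
  have fin: "finite M" using assms(2) by (simp add: is_model_def)
  obtain f :: "'m \<Rightarrow> nat" where f: "inj_on f M"
    using finite_imp_inj_to_nat_seg[OF fin] by (elim exE conjE)
  have "f ` I (Raw p) \<subseteq> f ` M \<and> f ` I (Bar p) = f ` M - f ` I (Raw p)" if "p \<in> P0" for p
    using assms(2) that inj_on_image_set_diff[OF f, of M "I (Raw p)"]
    by (simp add: is_model_def image_mono Diff_subset)
  then have "is_model P0 (f ` M) (\<lambda>x. f ` I x)"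
    using fin by (simp add: is_model_def)
  moreover have "\<forall>\<phi>\<in>\<Gamma>. sat (\<lambda>x. f ` I x) \<phi>"
  proof
    fix \<phi> assume \<phi>: "\<phi> \<in> \<Gamma>"
    have "sat (\<lambda>x. f ` I x) \<phi> \<longleftrightarrow> sat I \<phi>"
    proof (rule sat_image[OF f])
      fix p assume "p \<in> vars \<phi>"
      then have "p \<in> P0" using assms(1) \<phi> unfolding theory_over_def by blast
      then show "I (Raw p) \<subseteq> M \<and> I (Bar p) \<subseteq> M"
        using assms(2) by (simp add: is_model_def)
    qed
    with assms(3) \<phi> show "sat (\<lambda>x. f ` I x) \<phi>" by blast
  qed
  moreover have "card (f ` M) = card M" using f by (rule card_image)
  moreover have "card M \<ge> 1" using fin assms(4) by (simp add: Suc_le_eq card_gt_0_iff)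
  ultimately show ?thesis
    unfolding Spec_def by (intro CollectI conjI exI[of _ "f ` M"] exI[of _ "\<lambda>x. f ` I x"]) simp_all
qed

text \<open>
  The set \<open>\<U>\<close>: the set of raw variables is any set of elements of the type
  \<open>'v\<close>, and the theory may be infinite. HOL has no quantification over all sets of
  arbitrary type, so the type is a parameter. An infinite \<open>'v\<close> is needed to have
  arbitrarily many raw variables available; conversely, every set of raw variables embeds
  into some infinite type.
\<close>

definition spectra :: "'v itself \<Rightarrow> nat set set" where
  "spectra TYPE('v) = {Spec P0 \<Gamma> | (P0 :: 'v set) \<Gamma>. theory_over P0 \<Gamma>}"

definition T :: "nat \<Rightarrow> nat set" where
  "T k = {n \<in> Npos. n \<ge> k}"

definition E :: "nat \<Rightarrow> nat set" where
  "E k = {n \<in> Npos. n \<ge> k \<and> even n}"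

definition subbasis :: "nat set set" where
  "subbasis = {E 2} \<union> {T n | n. n \<in> Npos}"

text \<open>Relativising to \<open>Npos\<close> makes the empty intersection equal to \<open>Npos\<close>.\<close>

definition opens :: "nat set set" where
  "opens =
     {S. (arbitrary union_of ((finite intersection_of (\<lambda>B. B \<in> subbasis)) relative_to Npos)) S}"

end

theory Submission
  imports Defs "HOL-Library.Extended_Nat"
begin

text \<open>
  All three descriptions give the up-sets of one preorder on the positive integers: \<open>n\<close> lies
  below \<open>m\<close> if \<open>n \<le> m\<close> and, should \<open>n\<close> be even, \<open>m\<close> is even as well.

  A spectrum is an up-set because models can be enlarged without changing the truth value of any
  atomic sentence (\<open>Spec_add\<close>). If a universe of \<open>n\<close> points is to grow by \<open>k\<close> points, put
  all new points into the nouns that hold of more than half of the old points, and none into those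
  that hold of fewer than half. Nouns that hold of exactly half are the difficulty: they should all
  receive the same number of new points, and so should their complements, hence \<open>k / 2\<close> each. For odd
  \<open>n\<close> there are no such nouns and \<open>k\<close> is arbitrary; for even \<open>n\<close> an even \<open>k\<close> is required, and
  one old point \<open>c\<close> decides which half of the new points a noun gets.

  Up-sets are determined by their least odd and their least even element, which gives the explicit
  list (\<open>upset_cases\<close>). Each set on the list is a spectrum: a strictly increasing chain of
  cardinalities bounds the size of the universe from below, and a noun as large as its complement
  makes it even (\<open>Spec_threshold_theory\<close>). Finally, the least neighbourhood of \<open>n\<close> in the
  topology is the set of all numbers above \<open>n\<close> in the preorder, and so the open sets are
  its up-sets (\<open>opens_eq_upsets\<close>).
\<close>

section \<open>The order whose up-sets are the spectra\<close>

definition upset :: "nat set \<Rightarrow> bool" where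
  "upset S \<longleftrightarrow> S \<subseteq> Npos \<and> (\<forall>n\<in>S. \<forall>m\<ge>n. odd n \<or> even m \<longrightarrow> m \<in> S)"

lemma upsetD: "upset S \<Longrightarrow> n \<in> S \<Longrightarrow> n \<le> m \<Longrightarrow> odd n \<or> even m \<Longrightarrow> m \<in> S"
  unfolding upset_def by blast

lemma upset_T: "upset (T a)" and upset_E: "upset (E b)"
  unfolding upset_def T_def E_def by auto

lemma upset_Int: "upset S \<Longrightarrow> upset S' \<Longrightarrow> upset (S \<inter> S')"
  unfolding upset_def by blast

lemma upset_Union: "(\<And>S. S \<in> \<S> \<Longrightarrow> upset S) \<Longrightarrow> upset (\<Union>\<S>)"
  unfolding upset_def by blast

lemma upset_cases:
  assumes S: "upset S"
  obtains (empty) "S = {}"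
    | (T) a where "a \<in> Npos" "S = T a"
    | (E) b where "b \<in> Npos" "S = E b"
    | (T_E) a b where "a \<in> Npos" "b \<in> Npos" "b < a" "S = T a \<union> E b"
proof -
  have pos: "n \<in> Npos" if "n \<in> S" for n
    using S that unfolding upset_def by blast
  define b where "b = (LEAST n. n \<in> S \<and> even n)"
  define a where "a = (LEAST n. n \<in> S \<and> odd n)"
  have b: "b \<in> S" "even b" "b \<le> n" if "n \<in> S" "even n" for n
    using LeastI[of "\<lambda>n. n \<in> S \<and> even n" n] Least_le[of "\<lambda>n. n \<in> S \<and> even n" n] that
    unfolding b_def by auto
  have a: "a \<in> S" "odd a" "a \<le> n" if "n \<in> S" "odd n" for n
    using LeastI[of "\<lambda>n. n \<in> S \<and> odd n" n] Least_le[of "\<lambda>n. n \<in> S \<and> odd n" n] that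
    unfolding a_def by auto
  show thesis
  proof (cases "\<exists>n\<in>S. odd n")
    case True
    then have aS: "a \<in> S" "odd a" using a by blast+
    have above_a: "T a \<subseteq> S"
      using upsetD[OF S aS(1)] aS(2) by (auto simp: T_def)
    show thesis
    proof (cases "\<exists>n\<in>S. even n \<and> n < a")
      case True
      then have bS: "b \<in> S" "even b" "b < a"
        using b by (blast, blast, meson b(3) le_less_trans)
      have "E b \<subseteq> S"
        using upsetD[OF S bS(1)] by (auto simp: E_def)
      moreover have "S \<subseteq> T a \<union> E b"
        using a(3) b(3) pos by (auto simp: T_def E_def)
      ultimately have "S = T a \<union> E b" using above_a by blast
      then show thesis using T_E aS(1) bS pos by blast
    next
      case False
      then have "S \<subseteq> T a"
        using a(3) pos by (auto simp: T_def not_less)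
      then have "S = T a" using above_a by blast
      then show thesis using T aS(1) pos by blast
    qed
  next
    case no_odd: False
    show thesis
    proof (cases "S = {}")
      case True
      then show thesis by (rule empty)
    next
      case False
      then have bS: "b \<in> S" using no_odd b by blast
      have "E b \<subseteq> S"
        using upsetD[OF S bS] by (auto simp: E_def)
      moreover have "S \<subseteq> E b"
        using b(3) no_odd pos by (auto simp: E_def)
      ultimately show thesis using E bS pos by blast
    qed
  qed
qed


section \<open>Enlarging a model\<close>

lemma sat_cong_atoms:
  assumes "\<And>\<alpha>. set_atom \<alpha> \<subseteq> P0 \<Longrightarrow> sat_atom I \<alpha> \<longleftrightarrow> sat_atom I' \<alpha>" "vars \<phi> \<subseteq> P0"
  shows "sat I \<phi> \<longleftrightarrow> sat I' \<phi>"
  using assms(2) by (induction \<phi>) (simp_all add: assms(1))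

fun compl :: "'v noun \<Rightarrow> 'v noun" where
  "compl (Raw p) = Bar p"
| "compl (Bar p) = Raw p"

lemma set_noun_compl [simp]: "set_noun (compl x) = set_noun x"
  by (cases x) simp_all

lemma model_noun:
  assumes "is_model P0 M I" "set_noun x \<subseteq> P0"
  shows "I x \<subseteq> M" "I (compl x) = M - I x" "finite (I x)"
proof -
  show sub: "I x \<subseteq> M" and "I (compl x) = M - I x"
    using assms by (cases x; auto simp: is_model_def)+
  show "finite (I x)"
    using finite_subset[OF sub] assms(1) by (simp add: is_model_def)
qed

text \<open>
  Only inclusions and comparisons of cardinality need to be respected by the new points: an
  existential sentence denies that one noun is included in the complement of the other.
\<close>

lemma sat_extend:
  assumes M: "is_model P0 M I" and N: "is_model P0 N J" and disj: "M \<inter> N = {}"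
    and incl: "\<And>x y. set_noun x \<subseteq> P0 \<Longrightarrow> set_noun y \<subseteq> P0 \<Longrightarrow> I x \<subseteq> I y \<Longrightarrow> J x \<subseteq> J y"
    and size: "\<And>x y. set_noun x \<subseteq> P0 \<Longrightarrow> set_noun y \<subseteq> P0 \<Longrightarrow>
                 card (I x) \<le> card (I y) \<Longrightarrow> card (J x) \<le> card (J y)"
    and \<phi>: "vars \<phi> \<subseteq> P0"
  shows "sat (\<lambda>x. I x \<union> J x) \<phi> \<longleftrightarrow> sat I \<phi>"
proof (rule sat_cong_atoms[OF _ \<phi>])
  fix \<alpha> :: "'a atom"
  assume \<alpha>: "set_atom \<alpha> \<subseteq> P0"
  note in_M = model_noun[OF M] and in_N = model_noun[OF N]
  have sub: "I x \<union> J x \<subseteq> I y \<union> J y \<longleftrightarrow> I x \<subseteq> I y"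
    if "set_noun x \<subseteq> P0" "set_noun y \<subseteq> P0" for x y
    using in_M(1)[OF that(1)] in_N(1)[OF that(2)] disj incl[OF that] by blast
  have card: "card (I x \<union> J x) = card (I x) + card (J x)" if "set_noun x \<subseteq> P0" for x
    using in_M[OF that] in_N[OF that] disj by (intro card_Un_disjoint) auto
  have le: "card (I x \<union> J x) \<le> card (I y \<union> J y) \<longleftrightarrow> card (I x) \<le> card (I y)"
    if "set_noun x \<subseteq> P0" "set_noun y \<subseteq> P0" for x y
    using size[OF that] size[OF that(2,1)] by (simp add: card that) arith
  show "sat_atom (\<lambda>x. I x \<union> J x) \<alpha> \<longleftrightarrow> sat_atom I \<alpha>"
  proof (cases \<alpha>)
    case (All x y)
    then show ?thesis using sub[of x y] \<alpha> by simp
  next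
    case (Exists x y)
    then have xy: "set_noun x \<subseteq> P0" "set_noun y \<subseteq> P0" using \<alpha> by simp_all
    have "(I x \<union> J x) \<inter> (I y \<union> J y) = {} \<longleftrightarrow> I x \<union> J x \<subseteq> I (compl y) \<union> J (compl y)"
      using in_M(1)[OF xy(1)] in_N(1)[OF xy(1)] in_M(1)[OF xy(2)] in_N(1)[OF xy(2)] disj
      unfolding in_M(2)[OF xy(2)] in_N(2)[OF xy(2)] by blast
    also have "\<dots> \<longleftrightarrow> I x \<subseteq> I (compl y)"
      using sub xy by simp
    also have "\<dots> \<longleftrightarrow> I x \<inter> I y = {}"
      using in_M(1)[OF xy(1)] unfolding in_M(2)[OF xy(2)] by blast
    finally show ?thesis using Exists by simp
  next
    case (AtLeast x y)
    then show ?thesis using le[of y x] \<alpha> by simp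
  next
    case (More x y)
    then show ?thesis using le[of x y] \<alpha> by (simp flip: not_le)
  qed
qed

lemma is_model_extend:
  assumes "is_model P0 M I" "is_model P0 N J" "M \<inter> N = {}"
  shows "is_model P0 (M \<union> N) (\<lambda>x. I x \<union> J x)"
  using assms unfolding is_model_def by fastforce

lemma Spec_add:
  assumes th: "theory_over P0 \<Gamma>" and n: "n \<in> Spec P0 \<Gamma>" and parity: "odd n \<or> even k"
  shows "n + k \<in> Spec P0 \<Gamma>"
proof -
  obtain M :: "nat set" and I where M: "is_model P0 M I" and sat: "\<forall>\<phi>\<in>\<Gamma>. sat I \<phi>"
    and card_M: "card M = n" and "n \<ge> 1"
    using n unfolding Spec_def by blast
  then have fin: "finite M" and "M \<noteq> {}" by (auto simp: is_model_def)
  then obtain c where c: "c \<in> M" by blast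
  obtain N where N: "finite N" "card N = k" "M \<inter> N = {}"
    using fin infinite_arbitrarily_large[of "- M" k] by (auto simp: finite_compl)
  obtain D where D: "D \<subseteq> N" "card D = k div 2"
    using obtain_subset_with_card_n[of "k div 2" N] N(2) by auto
  then have card_ND: "card (N - D) = k - k div 2"
    using N by (simp add: card_Diff_subset finite_subset)
  \<comment> \<open>A noun of half size contains \<open>c\<close> exactly if its complement does not, so the two
      share out the new points. Rounding in \<open>k div 2\<close> is harmless: for odd \<open>k\<close> also \<open>n\<close> is
      odd, and no noun has half size.\<close>
  define J where "J x =
      (if 2 * card (I x) > n then N else if 2 * card (I x) < n then {}
       else if c \<in> I x then D else N - D)" for x
  note in_M = model_noun[OF M]
  have card_J: "card (J x) = (if 2 * card (I x) > n then k
      else if 2 * card (I x) < n then 0 else k div 2)" for x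
  proof (cases "2 * card (I x) = n")
    case True
    then have "k - k div 2 = k div 2" using parity by presburger
    then show ?thesis using True D(2) card_ND by (simp add: J_def)
  next
    case False
    then show ?thesis using N(2) by (simp add: J_def)
  qed
  have J: "is_model P0 N J"
    unfolding is_model_def
  proof (intro conjI ballI)
    fix p assume "p \<in> P0"
    then have p: "I (Raw p) \<subseteq> M" "I (Bar p) = M - I (Raw p)"
      using M by (auto simp: is_model_def)
    then have "card (I (Bar p)) = n - card (I (Raw p))"
      using card_M fin by (simp add: card_Diff_subset finite_subset)
    moreover have "card (I (Raw p)) \<le> n"
      using p(1) fin card_M card_mono by blast
    ultimately show "J (Bar p) = N - J (Raw p)"
      using p c D(1) unfolding J_def by auto
    show "J (Raw p) \<subseteq> N" using D(1) by (auto simp: J_def)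
  qed (rule N(1))
  have incl: "J x \<subseteq> J y" if x: "set_noun x \<subseteq> P0" and y: "set_noun y \<subseteq> P0" and "I x \<subseteq> I y" for x y
  proof (cases "card (I x) = card (I y)")
    case True
    \<comment> \<open>An inclusion between sets of the same size is an equality; this covers two nouns of half size.\<close>
    then have "I x = I y" using in_M(3)[OF y] \<open>I x \<subseteq> I y\<close> card_subset_eq by blast
    then show ?thesis by (simp add: J_def)
  next
    case False
    then have "card (I x) < card (I y)"
      using card_mono[OF in_M(3)[OF y] \<open>I x \<subseteq> I y\<close>] by simp
    then show ?thesis using D(1) by (auto simp: J_def)
  qed
  have size: "card (J x) \<le> card (J y)" if "card (I x) \<le> card (I y)" for x y
    using that by (auto simp: card_J)
  have "sat (\<lambda>x. I x \<union> J x) \<phi>" if "\<phi> \<in> \<Gamma>" for \<phi>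
    using sat_extend[OF M J N(3) incl size, of \<phi>] th sat that
    unfolding theory_over_def by blast
  moreover have "card (M \<union> N) = n + k"
    using card_Un_disjoint fin N card_M by blast
  ultimately show ?thesis
    using is_model_extend[OF M J N(3)] \<open>n \<ge> 1\<close> unfolding Spec_def by fastforce
qed

text \<open>For \<open>n \<le> m\<close>, the parity condition of the preorder is that of \<open>Spec_add\<close> with \<open>k = m - n\<close>.\<close>

lemma upset_Spec:
  assumes "theory_over P0 \<Gamma>"
  shows "upset (Spec P0 \<Gamma>)"
  unfolding upset_def
proof (intro conjI ballI allI impI)
  show "Spec P0 \<Gamma> \<subseteq> Npos" by (auto simp: Spec_def)
  fix n m assume "n \<in> Spec P0 \<Gamma>" "n \<le> m" "odd n \<or> even m"
  then show "m \<in> Spec P0 \<Gamma>"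
    using Spec_add[OF assms, of n "m - n"] by auto
qed


section \<open>Theories with prescribed spectra\<close>

text \<open>
  The noun \<open>v 0\<close> is reserved for parity and the chain consists of the nouns \<open>v (Suc i)\<close>. The
  threshold \<open>b\<close> applies to universes of any size, \<open>a\<close> only to those of odd size. Infinite
  thresholds let one family of theories cover all the sets on the list: a finite universe carries no
  infinite chain, so \<open>a = \<infinity>\<close> rules out every odd size and \<open>b = \<infinity>\<close> every size. Putting
  the parity alternative into each link of the second chain separately avoids a conjunction of
  infinitely many links.
\<close>

definition step :: "(nat \<Rightarrow> 'v) \<Rightarrow> nat \<Rightarrow> 'v sentence" where
  "step v i = Atom (More (Raw (v (Suc (Suc i)))) (Raw (v (Suc i))))"

definition halved :: "(nat \<Rightarrow> 'v) \<Rightarrow> 'v sentence" where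
  "halved v = And (Atom (AtLeast (Raw (v 0)) (Bar (v 0)))) (Atom (AtLeast (Bar (v 0)) (Raw (v 0))))"

definition threshold_theory :: "(nat \<Rightarrow> 'v) \<Rightarrow> enat \<Rightarrow> enat \<Rightarrow> 'v sentence set" where
  "threshold_theory v a b =
     {step v i | i. enat i < b} \<union> {Or (halved v) (step v i) | i. enat i < a}"

text \<open>
  As the disjunct \<open>halved v\<close> is the same in every sentence, it can be moved out of the quantifier.
\<close>

lemma sat_threshold_theory:
  "(\<forall>\<phi>\<in>threshold_theory v a b. sat I \<phi>) \<longleftrightarrow>
     (\<forall>i. enat i < b \<longrightarrow> sat I (step v i)) \<and>
     (sat I (halved v) \<or> (\<forall>i. enat i < a \<longrightarrow> sat I (step v i)))"
  unfolding threshold_theory_def by (auto simp: ball_Un)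

text \<open>
  Cardinalities increase strictly along the chain, so the noun after \<open>i\<close> links has at least \<open>i\<close>
  elements. A chain of more than \<open>card M\<close> links would outgrow the universe.
\<close>

lemma step_chain_bound:
  assumes "is_model UNIV M I" "\<And>i. enat i < c \<Longrightarrow> sat I (step v i)"
  shows "c \<le> enat (card M)"
proof (rule ccontr)
  assume "\<not> c \<le> enat (card M)"
  then have *: "sat I (step v i)" if "i \<le> card M" for i
    using that assms(2)[of i] by (meson enat_ord_simps(1) le_less_trans not_le)
  have "i \<le> card (I (Raw (v (Suc i))))" if "i \<le> Suc (card M)" for i
    using that
  proof (induction i)
    case (Suc i)
    then show ?case using *[of i] by (simp add: step_def)
  qed simp
  from this[of "Suc (card M)"] have "card M < card (I (Raw (v (Suc (Suc (card M))))))" by simp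
  moreover have "card (I (Raw (v (Suc (Suc (card M)))))) \<le> card M"
    using assms(1) by (intro card_mono) (auto simp: is_model_def)
  ultimately show False by simp
qed

lemma halved_even:
  assumes "is_model UNIV M I" "sat I (halved v)"
  shows "even (card M)"
proof -
  let ?H = "I (Raw (v 0))"
  have H: "?H \<subseteq> M" "I (Bar (v 0)) = M - ?H" "finite M"
    using assms(1) by (auto simp: is_model_def)
  then have "card (M - ?H) = card M - card ?H" "card ?H \<le> card M"
    by (auto simp: card_Diff_subset finite_subset card_mono)
  then have "card M = 2 * card ?H"
    using assms(2) H(2) by (simp add: halved_def) linarith
  then show ?thesis by simp
qed

lemma Spec_threshold_theory:
  fixes v :: "nat \<Rightarrow> 'v"
  assumes v: "inj v"
  shows "Spec UNIV (threshold_theory v a b) =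
           {n \<in> Npos. b \<le> enat n \<and> (even n \<or> a \<le> enat n)}"
proof (intro equalityI subsetI)
  fix n assume "n \<in> Spec UNIV (threshold_theory v a b)"
  then obtain M :: "nat set" and I where M: "is_model UNIV M I" "card M = n" and n: "n \<in> Npos"
    and sat: "\<forall>\<phi>\<in>threshold_theory v a b. sat I \<phi>"
    unfolding Spec_def by blast
  have "b \<le> enat n"
    using step_chain_bound[OF M(1), of b v] sat M(2) unfolding sat_threshold_theory by blast
  moreover have "a \<le> enat n" if "\<not> sat I (halved v)"
    using step_chain_bound[OF M(1), of a v] sat M(2) that unfolding sat_threshold_theory by blast
  ultimately show "n \<in> {n \<in> Npos. b \<le> enat n \<and> (even n \<or> a \<le> enat n)}"
    using halved_even[OF M(1)] M(2) n by blast
next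
  fix n assume n: "n \<in> {n \<in> Npos. b \<le> enat n \<and> (even n \<or> a \<le> enat n)}"
  define size :: "'v \<Rightarrow> nat" where
    "size p = (case inv v p of 0 \<Rightarrow> n div 2 | Suc i \<Rightarrow> i)" for p
  have size: "size (v 0) = n div 2" "size (v (Suc i)) = i" for i
    using v by (simp_all add: size_def)
  define I where
    "I x = (case x of Raw p \<Rightarrow> {..<min n (size p)} | Bar p \<Rightarrow> {size p..<n})" for x
  have M: "is_model UNIV {..<n} I"
    by (auto simp: is_model_def I_def)
  have card_Raw: "card (I (Raw p)) = min n (size p)"
    and card_Bar: "card (I (Bar p)) = n - size p" for p
    by (simp_all add: I_def)
  have "sat I (step v i)" if "enat i < c" "c \<le> enat n" for c i
  proof -
    have "i < n" using that by (metis enat_ord_simps(2) less_le_trans)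
    then show ?thesis by (simp add: step_def card_Raw size)
  qed
  moreover have "sat I (halved v)" if "even n"
    using that by (auto simp: halved_def card_Raw card_Bar size elim!: evenE)
  ultimately have "\<forall>\<phi>\<in>threshold_theory v a b. sat I \<phi>"
    using n unfolding sat_threshold_theory by blast
  then show "n \<in> Spec UNIV (threshold_theory v a b)"
    using M n unfolding Spec_def by fastforce
qed

lemma threshold_in_spectra:
  assumes "infinite (UNIV :: 'v set)"
  shows "{n \<in> Npos. b \<le> enat n \<and> (even n \<or> a \<le> enat n)} \<in> spectra TYPE('v)"
proof -
  obtain v :: "nat \<Rightarrow> 'v" where "inj v"
    using assms infinite_countable_subset by blast
  from Spec_threshold_theory[OF this, of a b, symmetric] show ?thesis
    unfolding spectra_def theory_over_def by blast
qed

lemma upset_in_spectra: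
  assumes "infinite (UNIV :: 'v set)" "upset S"
  shows "S \<in> spectra TYPE('v)"
proof -
  note spectrum = threshold_in_spectra[OF assms(1)]
  show ?thesis
    using assms(2)
  proof (cases rule: upset_cases)
    case empty
    then show ?thesis using spectrum[of \<infinity> \<infinity>] by simp
  next
    case (T a)
    then have "S = {n \<in> Npos. enat a \<le> enat n \<and> (even n \<or> enat a \<le> enat n)}"
      by (auto simp: T_def)
    then show ?thesis by (simp only: spectrum)
  next
    case (E b)
    then have "S = {n \<in> Npos. enat b \<le> enat n \<and> (even n \<or> \<infinity> \<le> enat n)}"
      by (auto simp: E_def)
    then show ?thesis by (simp only: spectrum)
  next
    case (T_E a b)
    then have "S = {n \<in> Npos. enat b \<le> enat n \<and> (even n \<or> enat a \<le> enat n)}"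
      by (auto simp: T_def E_def)
    then show ?thesis by (simp only: spectrum)
  qed
qed

lemma spectra_eq_upsets:
  assumes "infinite (UNIV :: 'v set)"
  shows "spectra TYPE('v) = Collect upset"
  using upset_in_spectra[OF assms] upset_Spec unfolding spectra_def by blast


section \<open>The topology\<close>

lemma upset_finite_intersection:
  assumes "(finite intersection_of (\<lambda>B. B \<in> subbasis)) S"
  shows "upset (Npos \<inter> S)"
proof -
  obtain \<B> where \<B>: "finite \<B>" "\<B> \<subseteq> subbasis" "S = \<Inter>\<B>"
    using assms unfolding intersection_of_def by auto
  have "upset (Npos \<inter> \<Inter>\<B>)"
    using \<B>(1,2)
  proof (induction \<B> rule: finite_induct)
    case empty
    then show ?case by (auto simp: upset_def)
  next
    case (insert B \<B>)
    have "upset B" using insert.prems upset_T upset_E by (auto simp: subbasis_def)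
    from upset_Int[OF this insert.IH] show ?case
      using insert.prems by (simp add: Int_left_commute)
  qed
  then show ?thesis using \<B>(3) by simp
qed

lemma opens_eq_upsets: "opens = Collect upset"
proof (intro equalityI subsetI)
  fix S assume "S \<in> opens"
  then obtain \<U> where "S = \<Union>\<U>"
    and "\<And>U. U \<in> \<U> \<Longrightarrow> ((finite intersection_of (\<lambda>B. B \<in> subbasis)) relative_to Npos) U"
    unfolding opens_def union_of_def by auto
  then show "S \<in> Collect upset"
    using upset_finite_intersection upset_Union[of \<U>] by (fastforce simp: relative_to_def)
next
  fix S assume "S \<in> Collect upset"
  then have S: "upset S" by simp
  define nbhd where "nbhd n = Npos \<inter> \<Inter>(if odd n then {T n} else {T n, E 2})" for n
  have nbhd: "nbhd n = {m \<in> Npos. n \<le> m \<and> (odd n \<or> even m)}" for n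
    by (cases "odd n") (auto simp: nbhd_def T_def E_def elim!: evenE)
  have basic: "((finite intersection_of (\<lambda>B. B \<in> subbasis)) relative_to Npos) (nbhd n)"
    if "n \<in> S" for n
  proof -
    have "n \<in> Npos" using S that unfolding upset_def by blast
    then have "(if odd n then {T n} else {T n, E 2}) \<subseteq> subbasis"
      by (auto simp: subbasis_def)
    moreover have "finite (if odd n then {T n} else {T n, E 2})" by simp
    ultimately have "(finite intersection_of (\<lambda>B. B \<in> subbasis))
                       (\<Inter>(if odd n then {T n} else {T n, E 2}))"
      unfolding intersection_of_def by blast
    then show ?thesis unfolding relative_to_def nbhd_def by blast
  qed
  have "\<Union>(nbhd ` S) = S"
  proof (intro equalityI subsetI)
    fix m assume "m \<in> \<Union>(nbhd ` S)"
    then show "m \<in> S" using upsetD[OF S] by (auto simp: nbhd)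
  next
    fix n assume "n \<in> S"
    moreover have "n \<in> Npos" using S \<open>n \<in> S\<close> unfolding upset_def by blast
    ultimately show "n \<in> \<Union>(nbhd ` S)" by (auto simp: nbhd)
  qed
  then show "S \<in> opens"
    unfolding opens_def union_of_def
    by (intro CollectI exI[of _ "nbhd ` S"]) (use basic in \<open>auto simp: arbitrary_def\<close>)
qed

lemma upsets_explicit:
  "Collect upset =
     {{}} \<union> {T a | a. a \<in> Npos} \<union> {E b | b. b \<in> Npos}
       \<union> {T a \<union> E b | a b. a \<in> Npos \<and> b \<in> Npos \<and> b < a}"
  (is "_ = ?list")
proof (intro equalityI subsetI)
  fix S assume "S \<in> Collect upset"
  then have "upset S" by simp
  then show "S \<in> ?list"
    by (cases rule: upset_cases) blast+
next
  fix S assume "S \<in> ?list"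
  moreover have "upset {}" by (simp add: upset_def)
  moreover have "upset (T a \<union> E b)" for a b
    using upset_Union[of "{T a, E b}"] upset_T upset_E by auto
  ultimately show "S \<in> Collect upset"
    using upset_T upset_E by auto
qed

theorem theorem4p5:
  assumes "infinite (UNIV :: 'v set)"
  shows "spectra TYPE('v) = opens \<and>
         opens =
           {{}} \<union> {T a | a. a \<in> Npos} \<union> {E b | b. b \<in> Npos}
             \<union> {T a \<union> E b | a b. a \<in> Npos \<and> b \<in> Npos \<and> b < a}"
  using spectra_eq_upsets[OF assms] upsets_explicit unfolding opens_eq_upsets by argo

end
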